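(* The following problem is undecidable: given $n\ge1$, $A_1,A_2\in\mathbb{Z}_{\max}^{n\times n}$, and $\alpha,\eta\in\mathbb{Z}_{\max}^{1\times n}$, is there a finite sequence $1\le i_1,\dots,i_k\le 2$, $k\ge1$, such that $\alpha A_{i_1}\cdots A_{i_k}\sim\eta$?
   Context: $\mathbb{Z}_{\max}=(\mathbb{Z}\cup\{-\infty\},\max,+)$ is the max-plus semiring: its addition is $\max$ (zero element $-\infty$) and its multiplication is the usual $+$ (with $-\infty$ absorbing). Matrix products are taken in this semiring: $(AB)_{ij}=\max_k(A_{ik}+B_{kj})$. The proportionality relation $\sim$ on vectors with $n$ entries in $\mathbb{Z}_{\max}$ is defined by: $u\sim v$ if there is $\lambda\in\mathbb{R}$ such that $u_i=\lambda+v_i$ for all $i$ (with $\lambda+(-\infty)=-\infty$). *)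

theory Defs
  imports
    "HOL-Library.Nat_Bijection"
    "HOL-Library.Extended_Real"
    "Jordan_Normal_Form.Matrix"
begin

section \<open>Decidable problems\<close>

text \<open>
  Computability is Kleene's: \<open>rec_eval f xs y\<close> says that the partial recursive function denoted by
  \<open>f\<close> is defined at the argument list \<open>xs\<close> with value \<open>y\<close>; if there is no such \<open>y\<close> (divergence,
  or an arity mismatch), the function is undefined at \<open>xs\<close>.
\<close>

datatype recf =
    Zero
  | Succ
  | Proj nat
  | Comp recf "recf list"
  | PrimRec recf recf
  | Mu recf

inductive rec_eval :: "recf \<Rightarrow> nat list \<Rightarrow> nat \<Rightarrow> bool" where
  Zero: "rec_eval Zero xs 0"
| Succ: "rec_eval Succ [x] (Suc x)"
| Proj: "i < length xs \<Longrightarrow> rec_eval (Proj i) xs (xs ! i)"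
| Comp: "list_all2 (\<lambda>g y. rec_eval g xs y) gs ys \<Longrightarrow> rec_eval f ys z \<Longrightarrow> rec_eval (Comp f gs) xs z"
| PrimRec_0: "rec_eval f xs y \<Longrightarrow> rec_eval (PrimRec f g) (0 # xs) y"
| PrimRec_Suc: "rec_eval (PrimRec f g) (x # xs) r \<Longrightarrow> rec_eval g (x # r # xs) y
    \<Longrightarrow> rec_eval (PrimRec f g) (Suc x # xs) y"
| Mu: "rec_eval f (y # xs) 0 \<Longrightarrow> \<forall>z<y. \<exists>v. rec_eval f (z # xs) (Suc v)
    \<Longrightarrow> rec_eval (Mu f) xs y"

lemma rec_eval_deterministic: "rec_eval f xs y \<Longrightarrow> rec_eval f xs z \<Longrightarrow> y = z"
proof (induction arbitrary: z rule: rec_eval.induct)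
  case (Comp xs gs ys f w)
  from Comp.prems obtain ys' where
    ys': "list_all2 (\<lambda>g y. rec_eval g xs y) gs ys'" and w: "rec_eval f ys' z"
    by (cases rule: rec_eval.cases) auto
  have "ys = ys'"
    using Comp.IH(1) ys' by (auto simp: list_all2_conv_all_nth intro!: nth_equalityI)
  with Comp.IH(2) w show ?case by simp
next
  case (PrimRec_Suc f g x xs r y)
  from PrimRec_Suc.prems obtain r' where
    "rec_eval (PrimRec f g) (x # xs) r'" "rec_eval g (x # r' # xs) z"
    by (cases rule: rec_eval.cases) auto
  with PrimRec_Suc.IH show ?case by blast
next
  case (Mu f y xs)
  from Mu.prems have z: "rec_eval f (z # xs) 0" "\<forall>u<z. \<exists>v. rec_eval f (u # xs) (Suc v)"
    by (cases rule: rec_eval.cases; auto)+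
  have "\<not> z < y" using Mu.IH(2) z(1) by fastforce
  moreover have "\<not> y < z" using Mu.IH(1) z(2) by fastforce
  ultimately show ?case by simp
next
  case (Zero xs)
  then show ?case by (cases rule: rec_eval.cases) auto
next
  case (Succ x)
  then show ?case by (cases rule: rec_eval.cases) auto
next
  case (Proj i xs)
  from Proj.prems show ?case by (cases rule: rec_eval.cases) auto
next
  case (PrimRec_0 f xs y g)
  from PrimRec_0.prems have "rec_eval f xs z" by (cases rule: rec_eval.cases) auto
  then show ?case by (rule PrimRec_0.IH)
qed

text \<open>
  A decision problem consists of a set \<open>I\<close> of instances, a coding \<open>c\<close> of instances by natural
  numbers and a property \<open>P\<close>. The behaviour of a decision procedure on numbers that do not code
  an instance is left unconstrained, including divergence.
\<close>

definition decidable :: "('a \<Rightarrow> nat) \<Rightarrow> 'a set \<Rightarrow> ('a \<Rightarrow> bool) \<Rightarrow> bool" where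
  "decidable c I P \<longleftrightarrow> (\<exists>f. \<forall>x\<in>I. rec_eval f [c x] (if P x then 1 else 0))"

section \<open>The max-plus semiring of the integers\<close>

datatype zmax = NegInf | Fin int

text \<open>
  Pitfall: the constants \<open>0\<close> and \<open>1\<close> of type \<^typ>\<open>zmax\<close> are the neutral elements of the semiring,
  that is \<open>- \<infinity>\<close> and the integer zero.
\<close>

instantiation zmax :: comm_semiring_1
begin

definition zero_zmax :: zmax where "0 = NegInf"

definition one_zmax :: zmax where "1 = Fin 0"

fun plus_zmax :: "zmax \<Rightarrow> zmax \<Rightarrow> zmax" where
  "NegInf + y = y"
| "Fin a + NegInf = Fin a"
| "Fin a + Fin b = Fin (max a b)"

fun times_zmax :: "zmax \<Rightarrow> zmax \<Rightarrow> zmax" where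
  "NegInf * y = NegInf"
| "Fin a * NegInf = NegInf"
| "Fin a * Fin b = Fin (a + b)"

instance
proof
  fix x y z :: zmax
  show "x + y + z = x + (y + z)" by (cases x; cases y; cases z) (auto simp: max.assoc)
  show "x + y = y + x" by (cases x; cases y) (auto simp: max.commute)
  show "0 + x = x" by (simp add: zero_zmax_def)
  show "x * y * z = x * (y * z)" by (cases x; cases y; cases z) auto
  show "x * y = y * x" by (cases x; cases y) auto
  show "1 * x = x" by (cases x) (auto simp: one_zmax_def)
  show "(x + y) * z = x * z + y * z" by (cases x; cases y; cases z) auto
  show "0 * x = 0" "x * 0 = 0" by (cases x; simp add: zero_zmax_def)+
  show "(0::zmax) \<noteq> 1" by (simp add: zero_zmax_def one_zmax_def)
qed

end

fun ereal_of_zmax :: "zmax \<Rightarrow> ereal" where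
  "ereal_of_zmax NegInf = - \<infinity>"
| "ereal_of_zmax (Fin a) = ereal (real_of_int a)"

text \<open>
  Row vectors are matrices with one row. The plus sign below is ordinary addition of extended
  reals; the factor \<open>l\<close> is finite, so that \<open>- \<infinity>\<close> entries have to match.
\<close>

definition proportional :: "zmax mat \<Rightarrow> zmax mat \<Rightarrow> bool" (infix \<open>\<sim>\<^sub>p\<close> 50) where
  "u \<sim>\<^sub>p v \<longleftrightarrow> dim_row u = dim_row v \<and> dim_col u = dim_col v \<and>
    (\<exists>l::real. \<forall>i<dim_row v. \<forall>j<dim_col v.
      ereal_of_zmax (u $$ (i, j)) = ereal l + ereal_of_zmax (v $$ (i, j)))"

section \<open>Projective reachability of a row vector\<close>

type_synonym reach_instance = "nat \<times> zmax mat \<times> zmax mat \<times> zmax mat \<times> zmax mat"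

definition reach_instances :: "reach_instance set" where
  "reach_instances = {(n, A\<^sub>1, A\<^sub>2, \<alpha>, \<eta>). n \<ge> 1 \<and>
     A\<^sub>1 \<in> carrier_mat n n \<and> A\<^sub>2 \<in> carrier_mat n n \<and>
     \<alpha> \<in> carrier_mat 1 n \<and> \<eta> \<in> carrier_mat 1 n}"

fun reachable :: "reach_instance \<Rightarrow> bool" where
  "reachable (n, A\<^sub>1, A\<^sub>2, \<alpha>, \<eta>) \<longleftrightarrow>
     (\<exists>is :: nat list. is \<noteq> [] \<and> set is \<subseteq> {1, 2} \<and>
        foldl (\<lambda>v i. v * (if i = 1 then A\<^sub>1 else A\<^sub>2)) \<alpha> is \<sim>\<^sub>p \<eta>)"

fun zmax_encode :: "zmax \<Rightarrow> nat" where
  "zmax_encode NegInf = 0"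
| "zmax_encode (Fin a) = Suc (int_encode a)"

definition mat_encode :: "zmax mat \<Rightarrow> nat" where
  "mat_encode A = list_encode (map (\<lambda>r. list_encode (map zmax_encode r)) (mat_to_list A))"

fun reach_encode :: "reach_instance \<Rightarrow> nat" where
  "reach_encode (n, A\<^sub>1, A\<^sub>2, \<alpha>, \<eta>) =
     list_encode [n, mat_encode A\<^sub>1, mat_encode A\<^sub>2, mat_encode \<alpha>, mat_encode \<eta>]"

lemma inj_zmax_encode: "inj zmax_encode"
proof (rule injI)
  fix x y assume "zmax_encode x = zmax_encode y"
  then show "x = y" by (cases x; cases y) (simp_all add: int_encode_eq)
qed

lemma inj_on_mat_encode: "inj_on mat_encode (carrier_mat m n)"
proof (rule inj_onI)
  fix A B assume carr: "A \<in> carrier_mat m n" "B \<in> carrier_mat m n"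
    and eq: "mat_encode A = mat_encode B"
  have "inj (\<lambda>r. list_encode (map zmax_encode r))"
    by (rule injI) (simp add: list_encode_eq inj_map_eq_map[OF inj_zmax_encode])
  with eq have *: "mat_to_list A = mat_to_list B"
    by (simp add: mat_encode_def list_encode_eq inj_map_eq_map)
  show "A = B"
  proof (rule eq_matI)
    fix i j assume "i < dim_row B" "j < dim_col B"
    moreover from this carr have "mat_to_list A ! i ! j = A $$ (i, j)" "mat_to_list B ! i ! j = B $$ (i, j)"
      by (simp_all add: mat_to_list_def)
    ultimately show "A $$ (i, j) = B $$ (i, j)" using * by simp
  qed (use carr in auto)
qed

lemma inj_on_reach_encode: "inj_on reach_encode reach_instances"
    by (rule inj_onI)
    (auto simp: reach_instances_def list_encode_eq simp del: list_encode.simps dest: inj_onD[OF inj_on_mat_encode])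

end

theory Submission
  imports Defs
begin

text \<open>
  A max-plus row vector can store the registers of a counter machine, and right multiplication by a
  matrix can increment, decrement, copy and clear them, since each of these operations sends every
  entry to a translate of some entry. What a linear map cannot do is to stop when a test fails.
  The remedy is a \<^emph>\<open>damage\<close> entry that is equal to the reference entry as long as all tests have
  succeeded. The matrix of the test ``\<open>x = 0\<close>'' for \<open>x \<ge> 0\<close> replaces the damage \<open>d\<close> by
  \<open>max d x\<close>, and a decrement of \<open>x\<close> replaces it by \<open>max d (1 - x)\<close>; for the latter the vector also
  holds \<open>- x\<close>. Damage is never repaired, and proportionality to a vector with equal reference and
  damage entries asks at the end that there is none. A wrong guess in the word thus cannot
  lead to the target, and reachability of \<open>\<eta>\<close> becomes existence of a terminating computation of a
  nondeterministic counter program (\<open>reachable_iff_run\<close>).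

  The control state is the block of the vector that is not \<open>- \<infinity>\<close>. A program is executed by
  rewriting the list of instructions that remain to be done. Only finitely many such lists occur,
  and each of them has at most two successors, so that two matrices suffice: the letters \<open>1\<close> and
  \<open>2\<close> choose the successor.

  Every partial recursive function is computed by such a program (\<open>computes_compile\<close>), in the sense
  that a terminating computation exists iff the function is defined, and then each of them yields its
  value. Hence for every partial recursive \<open>D\<close> there are matrices and a target \<open>\<eta>\<close> for which reachability from the vector
  that stores \<open>xs\<close> is equivalent to \<open>D(xs) = 0\<close>.

  Undecidability then follows by diagonalisation over the instances themselves: the inputs of the
  program are numbers that describe an instance. Given a decision procedure \<open>f\<close>, let \<open>D\<close> map
  such a description \<open>xs\<close> to the value of \<open>f\<close> at the instance that \<open>xs\<close> describes when \<open>xs\<close> itself is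
  written into the initial vector. The code of this instance is a primitive recursive function
  of \<open>xs\<close> (\<open>rec_eval_instance\<close>). If \<open>xs\<close> describes the matrices of \<open>D\<close>, then the instance is
  reachable iff \<open>D(xs) = 0\<close>, that is, iff \<open>f\<close> declares it unreachable.
\<close>

section \<open>Nondeterministic counter programs\<close>

datatype op = Nop | Reset | Clear nat | Inc nat | Dec nat | Copy nat nat | Test0 nat

type_synonym store = "nat \<Rightarrow> nat"

fun exec :: "op \<Rightarrow> store \<Rightarrow> store option" where
  "exec Nop s = Some s"
| "exec Reset s = Some (\<lambda>_. 0)"
| "exec (Clear r) s = Some (s(r := 0))"
| "exec (Inc r) s = Some (s(r := Suc (s r)))"
| "exec (Dec r) s = (if s r = 0 then None else Some (s(r := s r - 1)))"
| "exec (Copy r q) s = Some (s(r := s q))"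
| "exec (Test0 r) s = (if s r = 0 then Some s else None)"

lemma exec_guarded [simp]:
  "exec (Dec r) s = Some t \<longleftrightarrow> s r \<noteq> 0 \<and> t = s(r := s r - 1)"
  "exec (Test0 r) s = Some t \<longleftrightarrow> s r = 0 \<and> t = s"
  by (auto split: if_splits)

declare exec.simps(5,7) [simp del]

text \<open>
  A program is a list of instructions, and \<open>Star p\<close> repeats \<open>p\<close> an arbitrary number of times. Programs
  are lists rather than trees so that what remains to be done in the course of a computation is
  again a program: it serves as the control state below. The rules of \<open>run\<close> are accordingly the
  single transitions of a machine, at most two from each control state.
\<close>

datatype 'a instr = Op 'a | Star "'a instr list"

inductive run :: "op instr list \<Rightarrow> store \<Rightarrow> store \<Rightarrow> bool" where
  Nil: "run [] s s"
| Op: "exec a s = Some u \<Longrightarrow> run k u t \<Longrightarrow> run (Op a # k) s t"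
| Leave: "run k s t \<Longrightarrow> run (Star p # k) s t"
| Unroll: "run (p @ Star p # k) s t \<Longrightarrow> run (Star p # k) s t"

lemma run_Nil [simp]: "run [] s t \<longleftrightarrow> t = s"
  by (auto elim: run.cases intro: run.Nil)

lemma run_Op [simp]: "run (Op a # k) s t \<longleftrightarrow> (\<exists>u. exec a s = Some u \<and> run k u t)"
  by (auto elim: run.cases intro: run.Op)

lemma run_append [simp]: "run (p @ q) s t \<longleftrightarrow> (\<exists>u. run p s u \<and> run q u t)"
proof
  assume "run (p @ q) s t"
  then show "\<exists>u. run p s u \<and> run q u t"
  proof (induction "p @ q" s t arbitrary: p rule: run.induct)
    case (Op a s u k t)
    then show ?case by (cases p) (auto simp: Cons_eq_append_conv)
  next
    case (Leave k s t p')
    then show ?case by (cases p) (auto intro: run.intros)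
  next
    case (Unroll p' k s t)
    show ?case
    proof (cases p)
      case Nil
      then show ?thesis using Unroll.hyps by (auto intro: run.intros)
    next
      case (Cons i p'')
      then show ?thesis
        using Unroll.hyps(2)[of "p' @ Star p' # p''"] Unroll.hyps(3) by (auto intro: run.intros)
    qed
  qed auto
next
  assume "\<exists>u. run p s u \<and> run q u t"
  then obtain u where "run p s u" "run q u t" by blast
  then show "run (p @ q) s t"
    by (induction rule: run.induct) (auto intro: run.intros)
qed

text \<open>
  Unrolling a loop lengthens the program, so an induction on the derivation has to follow the
  loop while some prefix \<open>q\<close>, a partly executed body, is still in front of it.
\<close>

lemma run_Star_split:
  "run (q @ Star p # k) s t \<Longrightarrow> \<exists>u v. run q s u \<and> (run p)\<^sup>*\<^sup>* u v \<and> run k v t"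
proof (induction "q @ Star p # k" s t arbitrary: q rule: run.induct)
  case (Op a s u k' t)
  then show ?case by (auto simp: Cons_eq_append_conv)
next
  case (Leave k' s t p')
  then show ?case by (cases q) (auto intro: run.intros)
next
  case (Unroll p' k' s t)
  show ?case
  proof (cases q)
    case Nil
    then show ?thesis
      using Unroll.hyps(2)[of p] Unroll.hyps(3)
      by (auto intro: converse_rtranclp_into_rtranclp)
  next
    case (Cons i q')
    then have "k' = q' @ Star p # k" "i = Star p'" using Unroll.hyps(3) by auto
    then show ?thesis
      using Unroll.hyps(2)[of "p' @ Star p' # q'"] Cons
      by (metis append.assoc append_Cons run.Unroll)
  qed
qed auto

lemma run_Star [simp]: "run (Star p # k) s t \<longleftrightarrow> (\<exists>u. (run p)\<^sup>*\<^sup>* s u \<and> run k u t)"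
proof
  assume "run (Star p # k) s t"
  then show "\<exists>u. (run p)\<^sup>*\<^sup>* s u \<and> run k u t"
    using run_Star_split[of "[]" p k s t] by auto
next
  assume "\<exists>u. (run p)\<^sup>*\<^sup>* s u \<and> run k u t"
  then obtain u where "(run p)\<^sup>*\<^sup>* s u" "run k u t" by blast
  then show "run (Star p # k) s t"
  proof (induction rule: converse_rtranclp_induct)
    case (step s v)
    then have "run (p @ Star p # k) s t" by auto
    then show ?case by (rule run.Unroll)
  qed (rule run.Leave)
qed

section \<open>Compiling partial recursive functions\<close>

text \<open>
  The compiled program takes its arguments from the registers in the list \<open>xs\<close>, puts the value
  into the register \<open>d\<close> and may use all registers from \<open>b\<close> onwards as scratch space. In
  \<open>in_sequence\<close> the results go to consecutive registers.
\<close>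

fun in_sequence ::
  "(nat list \<Rightarrow> nat \<Rightarrow> nat \<Rightarrow> op instr list) list \<Rightarrow> nat list \<Rightarrow> nat \<Rightarrow> nat \<Rightarrow> op instr list" where
  "in_sequence [] xs d b = []"
| "in_sequence (c # cs) xs d b = c xs d b @ in_sequence cs xs (Suc d) b"

text \<open>
  A program without computations is the translation of a function that is applied to the wrong
  number of arguments.
\<close>

definition abort :: "nat \<Rightarrow> op instr list" where
  "abort d = [Op (Clear d), Op (Dec d)]"

text \<open>
  No loop tests its exit condition before leaving: the number of repetitions is guessed, and
  a \<open>Test0\<close> after the loop rejects a wrong guess. For primitive recursion the register \<open>b\<close> counts the
  remaining repetitions, \<open>b + 1\<close> the completed ones, and \<open>b + 2\<close> holds the current value. For
  minimisation \<open>b\<close> is the candidate; the \<open>Dec\<close> after a call ensures that only candidates with a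
  positive value are skipped.
\<close>

primrec compile :: "recf \<Rightarrow> nat list \<Rightarrow> nat \<Rightarrow> nat \<Rightarrow> op instr list" where
  "compile Zero = (\<lambda>xs d b. [Op (Clear d)])"
| "compile Succ = (\<lambda>xs d b. case xs of [x] \<Rightarrow> [Op (Copy d x), Op (Inc d)] | _ \<Rightarrow> abort d)"
| "compile (Proj i) = (\<lambda>xs d b. if i < length xs then [Op (Copy d (xs ! i))] else abort d)"
| "compile (Comp f gs) = (\<lambda>xs d b.
     in_sequence (map compile gs) xs b (b + length gs)
     @ compile f [b..<b + length gs] d (b + length gs))"
| "compile (PrimRec f g) = (\<lambda>xs d b. case xs of [] \<Rightarrow> abort d | x # ys \<Rightarrow>
     [Op (Copy b x), Op (Clear (b + 1))] @ compile f ys (b + 2) (b + 4)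
     @ [Star (Op (Dec b) # compile g ((b + 1) # (b + 2) # ys) (b + 3) (b + 4)
              @ [Op (Copy (b + 2) (b + 3)), Op (Inc (b + 1))]),
        Op (Test0 b), Op (Copy d (b + 2))])"
| "compile (Mu f) = (\<lambda>xs d b.
     [Op (Clear b),
      Star (compile f (b # xs) (b + 1) (b + 2) @ [Op (Dec (b + 1)), Op (Inc b)])]
     @ compile f (b # xs) (b + 1) (b + 2) @ [Op (Test0 (b + 1)), Op (Copy d b)])"

text \<open>
  Soundness includes that registers below \<open>b\<close> are preserved, for otherwise the arguments could be
  lost before they are used. It also covers divergence: where the function is
  undefined, the program has no terminating computation.
\<close>

definition computes :: "(nat list \<Rightarrow> nat \<Rightarrow> nat \<Rightarrow> op instr list) \<Rightarrow> recf \<Rightarrow> bool" where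
  "computes c f \<longleftrightarrow> (\<forall>xs d b s. set xs \<subseteq> {..<b} \<longrightarrow> d < b \<longrightarrow>
     (\<forall>t. run (c xs d b) s t \<longrightarrow>
        rec_eval f (map s xs) (t d) \<and> (\<forall>r<b. r \<noteq> d \<longrightarrow> t r = s r)) \<and>
     (\<forall>y. rec_eval f (map s xs) y \<longrightarrow> (\<exists>t. run (c xs d b) s t \<and> t d = y)))"

lemma computes_sound:
  assumes "computes c f" "run (c xs d b) s t" "set xs \<subseteq> {..<b}" "d < b"
  shows "rec_eval f (map s xs) (t d)" "r < b \<Longrightarrow> r \<noteq> d \<Longrightarrow> t r = s r"
  using assms unfolding computes_def by blast+

lemma computes_complete:
  assumes "computes c f" "rec_eval f (map s xs) y" "set xs \<subseteq> {..<b}" "d < b"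
  obtains t where "run (c xs d b) s t" "t d = y" "\<And>r. r < b \<Longrightarrow> r \<noteq> d \<Longrightarrow> t r = s r"
  using assms unfolding computes_def by metis

lemma run_abort [simp]: "\<not> run (abort d) s t"
  by (simp add: abort_def)

lemma map_store_cong: "(\<And>r. r < b \<Longrightarrow> t r = s r) \<Longrightarrow> set xs \<subseteq> {..<b} \<Longrightarrow> map t xs = map s xs"
  by auto

lemma in_sequence_sound:
  assumes "\<forall>g\<in>set gs. computes (compile g) g" "set xs \<subseteq> {..<d}" "d + length gs \<le> b"
    "run (in_sequence (map compile gs) xs d b) s t"
  shows "list_all2 (\<lambda>g y. rec_eval g (map s xs) y) gs (map t [d..<d + length gs])
    \<and> (\<forall>r<d. t r = s r)"
  using assms
proof (induction gs arbitrary: d s)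
  case (Cons g gs)
  from Cons.prems(4) obtain u where
    u: "run (compile g xs d b) s u" "run (in_sequence (map compile gs) xs (Suc d) b) u t"
    by auto
  have g: "computes (compile g) g" and db: "d < b" and xs: "set xs \<subseteq> {..<b}" "set xs \<subseteq> {..<Suc d}"
    using Cons.prems(1-3) by auto
  note first = computes_sound[OF g u(1) xs(1) db]
  have same: "map u xs = map s xs"
    using first(2) db Cons.prems(2) by (intro map_store_cong[of d]) auto
  have rest: "list_all2 (\<lambda>g y. rec_eval g (map u xs) y) gs (map t [Suc d..<Suc d + length gs])
    \<and> (\<forall>r<Suc d. t r = u r)"
    using Cons.prems u(2) xs(2) by (intro Cons.IH) auto
  have upt: "[d..<d + length (g # gs)] = d # [Suc d..<Suc d + length gs]"
    by (simp add: upt_conv_Cons del: upt_Suc)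
  show ?case unfolding upt using first rest same db by (simp del: upt_Suc)
qed simp

lemma in_sequence_complete:
  assumes "\<forall>g\<in>set gs. computes (compile g) g" "set xs \<subseteq> {..<d}" "d + length gs \<le> b"
    "list_all2 (\<lambda>g y. rec_eval g (map s xs) y) gs ys"
  shows "\<exists>t. run (in_sequence (map compile gs) xs d b) s t \<and> map t [d..<d + length gs] = ys"
  using assms
proof (induction gs arbitrary: d s ys)
  case (Cons g gs)
  from Cons.prems(4) obtain y zs where ys: "ys = y # zs" "rec_eval g (map s xs) y"
    "list_all2 (\<lambda>g y. rec_eval g (map s xs) y) gs zs"
    by (auto simp: list_all2_Cons1)
  have g: "computes (compile g) g" and db: "d < b" and xs: "set xs \<subseteq> {..<b}" "set xs \<subseteq> {..<Suc d}"
    using Cons.prems(1-3) by auto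
  obtain u where u: "run (compile g xs d b) s u" "u d = y"
    "\<And>r. r < b \<Longrightarrow> r \<noteq> d \<Longrightarrow> u r = s r"
    by (rule computes_complete[OF g ys(2) xs(1) db]) blast
  have same: "map u xs = map s xs"
    using u(3) db Cons.prems(2) by (intro map_store_cong[of d]) auto
  obtain t where t: "run (in_sequence (map compile gs) xs (Suc d) b) u t"
    "map t [Suc d..<Suc d + length gs] = zs"
    using Cons.IH[of "Suc d" u zs] Cons.prems ys(3) xs(2) same by auto
  have "t d = u d"
    using in_sequence_sound[OF _ xs(2) _ t(1)] Cons.prems(1,3) by auto
  moreover have upt: "[d..<d + length (g # gs)] = d # [Suc d..<Suc d + length gs]"
    by (simp add: upt_conv_Cons del: upt_Suc)
  ultimately have "map t [d..<d + length (g # gs)] = ys"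
    unfolding upt using u(2) t(2) ys(1) by (simp del: upt_Suc)
  moreover have "run (in_sequence (map compile (g # gs)) xs d b) s t"
    using u(1) t(1) by auto
  ultimately show ?case by blast
qed simp

inductive_cases rec_eval_CompE: "rec_eval (Comp f gs) xs z"
inductive_cases rec_eval_PrimRecE: "rec_eval (PrimRec f g) xs z"
inductive_cases rec_eval_MuE: "rec_eval (Mu f) xs z"

lemma computes_Comp:
  assumes f: "computes (compile f) f" and gs: "\<forall>g\<in>set gs. computes (compile g) g"
  shows "computes (compile (Comp f gs)) (Comp f gs)"
  unfolding computes_def
proof (intro allI impI conjI)
  fix xs d b s t r
  let ?b = "b + length gs" and ?ys = "[b..<b + length gs]"
  assume xs: "set xs \<subseteq> {..<b}" and d: "d < b"
  have ys: "set ?ys \<subseteq> {..<?b}" and d': "d < ?b" using d by auto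
  {
    assume "run (compile (Comp f gs) xs d b) s t"
    then obtain u where u: "run (in_sequence (map compile gs) xs b ?b) s u"
      "run (compile f ?ys d ?b) u t"
      by auto
    note args = in_sequence_sound[OF gs xs order_refl u(1)]
    note result = computes_sound[OF f u(2) ys d']
    show "rec_eval (Comp f gs) (map s xs) (t d)"
      using args result(1) by (auto intro: rec_eval.Comp)
    show "t r = s r" if "r < b" "r \<noteq> d"
      using args result(2)[of r] that by auto
  }
  show "\<exists>t. run (compile (Comp f gs) xs d b) s t \<and> t d = y"
    if "rec_eval (Comp f gs) (map s xs) y" for y
  proof -
    from that obtain zs where zs: "list_all2 (\<lambda>g y. rec_eval g (map s xs) y) gs zs"
      "rec_eval f zs y"
      by (rule rec_eval_CompE)
    obtain u where u: "run (in_sequence (map compile gs) xs b ?b) s u" "map u ?ys = zs"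
      using in_sequence_complete[OF gs xs order_refl zs(1)] by blast
    obtain t where "run (compile f ?ys d ?b) u t" "t d = y"
      using computes_complete[OF f zs(2)[folded u(2)] ys d'] by blast
    with u(1) show ?thesis by auto
  qed
qed

lemma rtranclp_invariant:
  assumes "R\<^sup>*\<^sup>* s t" "I s" "\<And>u v. R u v \<Longrightarrow> I u \<Longrightarrow> I v"
  shows "I t"
  using assms by (induction rule: rtranclp_induct) auto

text \<open>
  The loop invariant \<open>I\<close> says that the completed and the remaining repetitions add up to the
  recursion argument and that the current value is the one for the completed repetitions. It gives
  soundness at once; for completeness, a computation with any prescribed number of repetitions up
  to the recursion argument is constructed by induction.
\<close>

lemma computes_PrimRec:
  assumes f: "computes (compile f) f" and g: "computes (compile g) g"
  shows "computes (compile (PrimRec f g)) (PrimRec f g)"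
  unfolding computes_def
proof (intro allI impI)
  fix xs :: "nat list" and d b :: nat and s :: store
  assume xs: "set xs \<subseteq> {..<b}" and d: "d < b"
  let ?P = "\<lambda>t. rec_eval (PrimRec f g) (map s xs) (t d) \<and> (\<forall>r<b. r \<noteq> d \<longrightarrow> t r = s r)"
  show "(\<forall>t. run (compile (PrimRec f g) xs d b) s t \<longrightarrow> ?P t) \<and>
    (\<forall>y. rec_eval (PrimRec f g) (map s xs) y \<longrightarrow>
      (\<exists>t. run (compile (PrimRec f g) xs d b) s t \<and> t d = y))"
  proof (cases xs)
    case Nil
    then show ?thesis by (auto elim: rec_eval_PrimRecE)
  next
    case (Cons x ys)
    have x: "x < b" and ys: "set ys \<subseteq> {..<b}" using xs Cons by auto
    let ?s0 = "s(b := s x, b + 1 := 0)"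
    let ?init = "compile f ys (b + 2) (b + 4)"
    let ?call = "compile g ((b + 1) # (b + 2) # ys) (b + 3) (b + 4)"
    let ?body = "Op (Dec b) # ?call @ [Op (Copy (b + 2) (b + 3)), Op (Inc (b + 1))]"
    have whole: "run (compile (PrimRec f g) xs d b) s t \<longleftrightarrow>
      (\<exists>u. run ?init ?s0 u \<and>
        (\<exists>v. (run ?body)\<^sup>*\<^sup>* u v \<and> v b = 0 \<and> t = v(d := v (b + 2))))" for t
      by (simp add: Cons)
    have ys4: "set ys \<subseteq> {..<b + 4}" and args4: "set ((b + 1) # (b + 2) # ys) \<subseteq> {..<b + 4}"
      using ys by auto
    have s0: "map ?s0 ys = map s ys" using ys by (intro map_store_cong[of b]) auto
    define I where "I u \<longleftrightarrow> u (b + 1) + u b = s x \<and>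
      rec_eval (PrimRec f g) (u (b + 1) # map s ys) (u (b + 2)) \<and> (\<forall>r<b. u r = s r)" for u
    have I_init: "I u" if "run ?init ?s0 u" for u
    proof -
      have "rec_eval f (map s ys) (u (b + 2))"
        using computes_sound(1)[OF f that ys4] unfolding s0 by simp
      moreover have "u r = ?s0 r" if "r < b + 2" for r
        using computes_sound(2)[OF f \<open>run ?init ?s0 u\<close> ys4, of r] that by simp
      ultimately show ?thesis by (simp add: I_def rec_eval.PrimRec_0)
    qed
    have I_body: "I v" if body: "run ?body u v" and I: "I u" for u v
    proof -
      let ?u = "u(b := u b - 1)"
      from body obtain w where w: "u b \<noteq> 0" "run ?call ?u w"
        and v: "v = w(b + 2 := w (b + 3), b + 1 := Suc (w (b + 1)))"
        by auto
      note call = computes_sound[OF g w(2) args4]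
      have same: "map ?u ys = map s ys"
        using ys I by (intro map_store_cong[of b]) (auto simp: I_def)
      have "rec_eval g (u (b + 1) # u (b + 2) # map s ys) (w (b + 3))"
        using call(1) unfolding list.map same by simp
      moreover have "w (b + 1) = u (b + 1)" "w b = u b - 1" "\<forall>r<b. w r = u r"
        using call(2) by auto
      ultimately show ?thesis
        using I w(1) by (auto simp: I_def v intro: rec_eval.PrimRec_Suc)
    qed
    have sound: "?P t" if run: "run (compile (PrimRec f g) xs d b) s t" for t
    proof -
      from run obtain u v where u: "run ?init ?s0 u" and uv: "(run ?body)\<^sup>*\<^sup>* u v"
        and v: "v b = 0" "t = v(d := v (b + 2))"
        unfolding whole by blast
      have "I v" by (rule rtranclp_invariant[OF uv, of I, OF I_init[OF u] I_body])
      then show ?thesis using v Cons d by (auto simp: I_def)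
    qed
    have reach: "\<exists>u v. run ?init ?s0 u \<and> (run ?body)\<^sup>*\<^sup>* u v \<and> v (b + 1) = m \<and> v (b + 2) = y \<and> I v"
      if "rec_eval (PrimRec f g) (m # map s ys) y" "m \<le> s x" for m y
      using that
    proof (induction m arbitrary: y)
      case 0
      from 0 have "rec_eval f (map ?s0 ys) y"
        unfolding s0 by (auto elim: rec_eval_PrimRecE)
      then obtain u where u: "run ?init ?s0 u" "u (b + 2) = y"
        "\<And>r. r < b + 4 \<Longrightarrow> r \<noteq> b + 2 \<Longrightarrow> u r = ?s0 r"
        by (rule computes_complete[OF f _ ys4, of _ _ "b + 2"]) auto
      have "u (b + 1) = 0" using u(3)[of "b + 1"] by simp
      with u(1,2) I_init[OF u(1)] show ?case by blast
    next
      case (Suc m)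
      from Suc.prems(1) obtain r where r: "rec_eval (PrimRec f g) (m # map s ys) r"
        "rec_eval g (m # r # map s ys) y"
        by (auto elim: rec_eval_PrimRecE)
      obtain u v where uv: "run ?init ?s0 u" "(run ?body)\<^sup>*\<^sup>* u v"
        and v: "v (b + 1) = m" "v (b + 2) = r" "I v"
        using Suc.IH[OF r(1) Suc_leD[OF Suc.prems(2)]] by blast
      let ?v = "v(b := v b - 1)"
      have vb: "v b \<noteq> 0" using v Suc.prems(2) by (auto simp: I_def)
      have same: "map ?v ys = map s ys"
        using ys v(3) by (intro map_store_cong[of b]) (auto simp: I_def)
      have "rec_eval g (map ?v ((b + 1) # (b + 2) # ys)) y"
        unfolding list.map same using r(2) v by simp
      then obtain w where w: "run ?call ?v w" "w (b + 3) = y"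
        "\<And>r. r < b + 4 \<Longrightarrow> r \<noteq> b + 3 \<Longrightarrow> w r = ?v r"
        by (rule computes_complete[OF g _ args4, of _ _ "b + 3"]) auto
      let ?w = "w(b + 2 := w (b + 3), b + 1 := Suc (w (b + 1)))"
      have body: "run ?body v ?w" using vb w(1) by auto
      have "?w (b + 1) = Suc m" using w(3)[of "b + 1"] v by simp
      moreover have "?w (b + 2) = y" using w(2) by simp
      ultimately show ?case
        using uv body I_body[OF body v(3)] by (blast intro: rtranclp.rtrancl_into_rtrancl)
    qed
    have complete: "\<exists>t. run (compile (PrimRec f g) xs d b) s t \<and> t d = y"
      if eval: "rec_eval (PrimRec f g) (map s xs) y" for y
    proof -
      have "rec_eval (PrimRec f g) (s x # map s ys) y" using eval Cons by simp
      from reach[OF this order_refl] obtain u v where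
        uv: "run ?init ?s0 u" "(run ?body)\<^sup>*\<^sup>* u v"
        and v: "v (b + 1) = s x" "v (b + 2) = y" "I v"
        by blast
      have "v b = 0" using v by (simp add: I_def)
      then have "run (compile (PrimRec f g) xs d b) s (v(d := v (b + 2)))"
        unfolding whole using uv by blast
      then show ?thesis using v(2) by (metis fun_upd_same)
    qed
    from sound complete show ?thesis by blast
  qed
qed

text \<open>
  Here the invariant \<open>I\<close> says that the function has a positive value at every number below the
  candidate, which is the side condition of minimisation.
\<close>

lemma computes_Mu:
  assumes f: "computes (compile f) f"
  shows "computes (compile (Mu f)) (Mu f)"
  unfolding computes_def
proof (intro allI impI)
  fix xs :: "nat list" and d b :: nat and s :: store
  assume xs: "set xs \<subseteq> {..<b}" and d: "d < b"
  let ?P = "\<lambda>t. rec_eval (Mu f) (map s xs) (t d) \<and> (\<forall>r<b. r \<noteq> d \<longrightarrow> t r = s r)"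
  let ?s0 = "s(b := 0)"
  let ?call = "compile f (b # xs) (b + 1) (b + 2)"
  let ?body = "?call @ [Op (Dec (b + 1)), Op (Inc b)]"
  have whole: "run (compile (Mu f) xs d b) s t \<longleftrightarrow>
    (\<exists>u. (run ?body)\<^sup>*\<^sup>* ?s0 u \<and>
      (\<exists>v. run ?call u v \<and> v (b + 1) = 0 \<and> t = v(d := v b)))" for t
    by simp
  have args: "set (b # xs) \<subseteq> {..<b + 2}" using xs by auto
  define I where "I u \<longleftrightarrow> (\<forall>r<b. u r = s r) \<and>
    (\<forall>z<u b. \<exists>v. rec_eval f (z # map s xs) (Suc v))" for u
  have I_map: "map u (b # xs) = u b # map s xs" if "I u" for u
    using that xs map_store_cong[of b u s xs] by (auto simp: I_def)
  have call: "rec_eval f (u b # map s xs) (v (b + 1)) \<and> v b = u b \<and> (\<forall>r<b. v r = s r)"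
    if "I u" "run ?call u v" for u v
  proof -
    have "rec_eval f (u b # map s xs) (v (b + 1))"
      using computes_sound(1)[OF f that(2) args] unfolding I_map[OF that(1)] by simp
    moreover have "v r = u r" if "r < b + 1" for r
      using computes_sound(2)[OF f \<open>run ?call u v\<close> args, of r] that by simp
    ultimately show ?thesis using that(1) by (simp add: I_def)
  qed
  have I_init: "I ?s0" by (simp add: I_def)
  have I_body: "I v" if "run ?body u v" and I: "I u" for u v
  proof -
    from that(1) obtain w where w: "run ?call u w" "w (b + 1) \<noteq> 0"
      and v: "v = w(b + 1 := w (b + 1) - 1, b := Suc (w b))"
      by auto
    obtain y where "w (b + 1) = Suc y" using w(2) by (cases "w (b + 1)") auto
    then have "\<exists>v. rec_eval f (u b # map s xs) (Suc v)" using call[OF I w(1)] by auto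
    then show ?thesis using call[OF I w(1)] I by (auto simp: I_def v less_Suc_eq)
  qed
  have sound: "?P t" if run: "run (compile (Mu f) xs d b) s t" for t
  proof -
    from run obtain u v where u: "(run ?body)\<^sup>*\<^sup>* ?s0 u" and v: "run ?call u v"
      "v (b + 1) = 0" "t = v(d := v b)"
      unfolding whole by blast
    have I: "I u" by (rule rtranclp_invariant[OF u, of I, OF I_init I_body])
    have "rec_eval (Mu f) (map s xs) (u b)"
      using call[OF I v(1)] v(2) I by (auto simp: I_def intro: rec_eval.Mu)
    then show ?thesis using call[OF I v(1)] v(3) by auto
  qed
  have reach: "\<exists>u. (run ?body)\<^sup>*\<^sup>* ?s0 u \<and> u b = m \<and> I u"
    if "\<forall>z<m. \<exists>v. rec_eval f (z # map s xs) (Suc v)" for m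
    using that
  proof (induction m)
    case 0
    show ?case by (rule exI[of _ ?s0]) (use I_init in \<open>simp del: fun_upd_apply add: fun_upd_same\<close>)
  next
    case (Suc m)
    obtain u where u: "(run ?body)\<^sup>*\<^sup>* ?s0 u" "u b = m" "I u"
      using Suc.IH Suc.prems less_SucI by blast
    obtain y where "rec_eval f (u b # map s xs) (Suc y)"
      using Suc.prems u(2) by blast
    then have "rec_eval f (map u (b # xs)) (Suc y)" unfolding I_map[OF u(3)] .
    then obtain w where w: "run ?call u w" "w (b + 1) = Suc y"
      by (rule computes_complete[OF f _ args, of _ _ "b + 1"]) auto
    let ?w = "w(b + 1 := w (b + 1) - 1, b := Suc (w b))"
    have body: "run ?body u ?w" using w by auto
    have "?w b = Suc m" using call[OF u(3) w(1)] u(2) by simp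
    then show ?case
      using u(1) body I_body[OF body u(3)] by (blast intro: rtranclp.rtrancl_into_rtrancl)
  qed
  have complete: "\<exists>t. run (compile (Mu f) xs d b) s t \<and> t d = y"
    if eval: "rec_eval (Mu f) (map s xs) y" for y
  proof -
    from eval have y: "rec_eval f (y # map s xs) 0"
      "\<forall>z<y. \<exists>v. rec_eval f (z # map s xs) (Suc v)"
      by (auto elim: rec_eval_MuE)
    obtain u where u: "(run ?body)\<^sup>*\<^sup>* ?s0 u" "u b = y" "I u" using reach[OF y(2)] by blast
    have "rec_eval f (map u (b # xs)) 0" unfolding I_map[OF u(3)] u(2) by (rule y(1))
    then obtain v where v: "run ?call u v" "v (b + 1) = 0"
      by (rule computes_complete[OF f _ args, of _ _ "b + 1"]) auto
    then have "run (compile (Mu f) xs d b) s (v(d := v b))"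
      unfolding whole using u(1) by blast
    moreover have "v b = y" using call[OF u(3) v(1)] u(2) by simp
    ultimately show ?thesis by (metis fun_upd_same)
  qed
  from sound complete
  show "(\<forall>t. run (compile (Mu f) xs d b) s t \<longrightarrow> ?P t) \<and>
    (\<forall>y. rec_eval (Mu f) (map s xs) y \<longrightarrow> (\<exists>t. run (compile (Mu f) xs d b) s t \<and> t d = y))"
    by blast
qed

lemma computes_compile: "computes (compile f) f"
proof (induction f)
  case Zero
  show ?case by (auto simp: computes_def intro: rec_eval.Zero elim: rec_eval.cases)
next
  case Succ
  show ?case
    by (auto simp: computes_def intro: rec_eval.Succ elim: rec_eval.cases split: list.split)
next
  case (Proj i)
  have "rec_eval (Proj i) xs y \<longleftrightarrow> i < length xs \<and> y = xs ! i" for xs y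
    by (auto intro: rec_eval.Proj elim: rec_eval.cases)
  then show ?case by (auto simp: computes_def)
next
  case (Comp f gs)
  then show ?case by (intro computes_Comp) auto
next
  case (PrimRec f g)
  then show ?case by (rule computes_PrimRec)
next
  case (Mu f)
  then show ?case by (rule computes_Mu)
qed

section \<open>Vectors that hold a configuration\<close>

text \<open>
  Each operation moves every coordinate to a translate of a coordinate (\<open>source\<close>); on top of this a
  guarded operation raises \<open>Dmg\<close> to at least a translate of some coordinate (\<open>guard\<close>), which exceeds
  \<open>0\<close> exactly if the operation is not applicable: \<open>1 - x\<close> for a decrement of \<open>x\<close>, and \<open>x\<close> for the test
  \<open>x = 0\<close>. The negated copy \<open>Neg r\<close> of a register exists for the sake of the former. Here
  \<open>weight a\<close> is the matrix of the operation \<open>a\<close> and \<open>transfer a\<close> its action on row vectors.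
\<close>

datatype coord = Ref | Dmg | Pos nat | Neg nat

fun source :: "op \<Rightarrow> coord \<Rightarrow> coord \<times> int" where
  "source Reset (Pos r) = (Ref, 0)"
| "source Reset (Neg r) = (Ref, 0)"
| "source (Clear q) (Pos r) = (if r = q then Ref else Pos r, 0)"
| "source (Clear q) (Neg r) = (if r = q then Ref else Neg r, 0)"
| "source (Inc q) (Pos r) = (Pos r, if r = q then 1 else 0)"
| "source (Inc q) (Neg r) = (Neg r, if r = q then - 1 else 0)"
| "source (Dec q) (Pos r) = (Pos r, if r = q then - 1 else 0)"
| "source (Dec q) (Neg r) = (Neg r, if r = q then 1 else 0)"
| "source (Copy q p) (Pos r) = (Pos (if r = q then p else r), 0)"
| "source (Copy q p) (Neg r) = (Neg (if r = q then p else r), 0)"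
| "source _ c = (c, 0)"

fun guard :: "op \<Rightarrow> (coord \<times> int) option" where
  "guard (Dec r) = Some (Neg r, 1)"
| "guard (Test0 r) = Some (Pos r, 0)"
| "guard _ = None"

definition weight :: "op \<Rightarrow> coord \<Rightarrow> coord \<Rightarrow> zmax" where
  "weight a c c' =
     (if c = fst (source a c') then Fin (snd (source a c')) else 0) +
     (case guard a of Some (g, w) \<Rightarrow> if c' = Dmg \<and> c = g then Fin w else 0 | None \<Rightarrow> 0)"

definition transfer :: "op \<Rightarrow> (coord \<Rightarrow> zmax) \<Rightarrow> coord \<Rightarrow> zmax" where
  "transfer a u c' =
     u (fst (source a c')) * Fin (snd (source a c')) +
     (case guard a of Some (g, w) \<Rightarrow> if c' = Dmg then u g * Fin w else 0 | None \<Rightarrow> 0)"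

fun store_vec :: "store \<Rightarrow> coord \<Rightarrow> zmax" where
  "store_vec s Ref = Fin 0"
| "store_vec s Dmg = Fin 0"
| "store_vec s (Pos r) = Fin (int (s r))"
| "store_vec s (Neg r) = Fin (- int (s r))"

text \<open>
  The vectors from which the target can no longer be reached: those that carry damage, and the zero
  vector of the semiring, which results from reading a letter after the program has ended.
\<close>

definition spoilt :: "(coord \<Rightarrow> zmax) \<Rightarrow> bool" where
  "spoilt u \<longleftrightarrow> u = (\<lambda>_. 0) \<or> (u Ref = Fin 0 \<and> (\<exists>x>0. u Dmg = Fin x))"

lemma zmax_zero [simp]: "NegInf = 0" "Fin x \<noteq> 0"
  by (simp_all add: zero_zmax_def)

lemma ereal_of_zmax_zero [simp]: "ereal_of_zmax 0 = - \<infinity>"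
  by (simp add: zero_zmax_def del: zmax_zero)

lemma source_Ref_Dmg [simp]: "source a Ref = (Ref, 0)" "source a Dmg = (Dmg, 0)"
  by (cases a; simp)+

lemma transfer_store_vec: "exec a s = Some t \<Longrightarrow> transfer a (store_vec s) = store_vec t"
  by (rule ext, rename_tac c, case_tac c; cases a) (auto simp: transfer_def)

lemma transfer_stuck: "exec a s = None \<Longrightarrow> spoilt (transfer a (store_vec s))"
  by (cases a) (auto simp: transfer_def spoilt_def exec.simps(5,7) split: if_splits)

lemma Fin_zero_times [simp]: "u * Fin 0 = u"
  by (cases u) auto

lemma Fin_plus_exists: "\<exists>y\<ge>x. Fin x + v = Fin y"
  by (cases v) (auto simp: exI[of _ "max _ _"] simp flip: zero_zmax_def)

text \<open>
  All operations have weight \<open>0\<close> on the diagonal at \<open>Ref\<close> and \<open>Dmg\<close>, and nothing else enters \<open>Ref\<close>.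
  Hence damage persists, whatever the other coordinates become after the first failure.
\<close>

lemma spoilt_transfer:
  assumes "spoilt u" shows "spoilt (transfer a u)"
proof (cases "u = (\<lambda>_. 0)")
  case True
  then have "transfer a u = (\<lambda>_. 0)"
    by (auto simp: transfer_def split: option.split)
  then show ?thesis by (simp add: spoilt_def)
next
  case False
  then obtain x where u: "u Ref = Fin 0" "u Dmg = Fin x" "x > 0"
    using assms by (auto simp: spoilt_def)
  obtain y where "y \<ge> x" "transfer a u Dmg = Fin y"
    using Fin_plus_exists[of x] u(2) by (fastforce simp: transfer_def)
  moreover have "transfer a u Ref = Fin 0"
    using u(1) by (auto simp: transfer_def split: option.split)
  ultimately show ?thesis using u(3) by (auto simp: spoilt_def)
qed

lemma sum_weight:
  assumes "finite C" "fst (source a c') \<in> C" "\<And>g w. guard a = Some (g, w) \<Longrightarrow> g \<in> C"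
  shows "(\<Sum>c\<in>C. u c * weight a c c') = transfer a u c'"
proof -
  have 1: "(\<Sum>c\<in>C. u c * (if c = fst (source a c') then Fin (snd (source a c')) else 0)) =
      u (fst (source a c')) * Fin (snd (source a c'))"
    using assms(1,2) by (simp add: if_distrib[of "(*) _"] sum.delta cong: if_cong)
  have 2: "(\<Sum>c\<in>C. u c *
        (case guard a of Some (g, w) \<Rightarrow> if c' = Dmg \<and> c = g then Fin w else 0 | None \<Rightarrow> 0)) =
      (case guard a of Some (g, w) \<Rightarrow> if c' = Dmg then u g * Fin w else 0 | None \<Rightarrow> 0)"
    using assms(1,3)
    by (cases "guard a"; cases "c' = Dmg")
      (auto simp: if_distrib[of "(*) _"] sum.delta cong: if_cong)
  show ?thesis by (simp add: weight_def transfer_def distrib_left sum.distrib 1 2)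
qed

section \<open>Control flow with two successors\<close>

text \<open>
  Where a control state has only one successor, both letters lead to it. In this way two letters
  suffice for a program of any size, and no coding of a larger alphabet is necessary.
\<close>

fun succ :: "bool \<Rightarrow> op instr list \<Rightarrow> (op \<times> op instr list) option" where
  "succ b [] = None"
| "succ b (Op a # k) = Some (a, k)"
| "succ b (Star p # k) = Some (Nop, if b then k else p @ Star p # k)"

lemma run_succ: "succ b k = Some (a, k') \<Longrightarrow> exec a s = Some s' \<Longrightarrow> run k' s' t \<Longrightarrow> run k s t"
  by (induction b k rule: succ.induct)
    (auto simp del: run_Op run_Star run_append intro: run.intros split: if_splits)

text \<open>
  A finite set that contains all control states which arise from \<open>p @ k\<close> until \<open>k\<close> is left over. The
  body of a loop is always continued by the loop itself, so that unrolling does not create new control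
  states time and again.
\<close>

fun conts :: "op instr list \<Rightarrow> op instr list \<Rightarrow> op instr list set" where
  "conts [] k = {k}"
| "conts (Op a # p) k = insert (Op a # p @ k) (conts p k)"
| "conts (Star q # p) k = insert (Star q # p @ k) (conts q (Star q # p @ k) \<union> conts p k)"

lemma finite_conts: "finite (conts p k)"
  by (induction p k rule: conts.induct) auto

lemma conts_start: "p @ k \<in> conts p k"
  by (induction p k rule: conts.induct) auto

lemma conts_end: "k \<in> conts p k"
  by (induction p k rule: conts.induct) auto

lemma conts_closed: "q \<in> conts p k \<Longrightarrow> succ b q = Some (a, q') \<Longrightarrow> q = k \<or> q' \<in> conts p k"
proof (induction p k arbitrary: q rule: conts.induct)
  case (3 p' p k)
  have "q' \<in> conts (Star p' # p) k" if "q = Star p' # p @ k"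
    using that 3(4) conts_start[of p' "Star p' # p @ k"] conts_start[of p k]
    by (auto split: if_splits)
  with 3 show ?case by (simp only: conts.simps insert_iff Un_iff) blast
qed (auto simp: conts_start)

definition ops :: "op instr list \<Rightarrow> op set" where
  "ops p = \<Union> (set_instr ` set p)"

lemma ops_simps [simp]:
  "ops [] = {}" "ops (Op a # p) = insert a (ops p)" "ops (Star q # p) = ops q \<union> ops p"
  "ops (p @ q) = ops p \<union> ops q"
  by (auto simp: ops_def)

lemma finite_set_instr: "finite (set_instr i)"
  by (induction i) auto

lemma ops_conts: "q \<in> conts p k \<Longrightarrow> ops q \<subseteq> ops p \<union> ops k"
  by (induction p k arbitrary: q rule: conts.induct) fastforce+

fun regs :: "op \<Rightarrow> nat set" where
  "regs Nop = {}"
| "regs Reset = {}"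
| "regs (Clear r) = {r}"
| "regs (Inc r) = {r}"
| "regs (Dec r) = {r}"
| "regs (Copy r q) = {r, q}"
| "regs (Test0 r) = {r}"

definition coords :: "nat \<Rightarrow> coord set" where
  "coords b = {Ref, Dmg} \<union> Pos ` {..<b} \<union> Neg ` {..<b}"

lemma source_in_coords: "regs a \<subseteq> {..<b} \<Longrightarrow> c \<in> coords b \<Longrightarrow> fst (source a c) \<in> coords b"
  by (cases a; cases c) (auto simp: coords_def)

lemma guard_in_coords: "regs a \<subseteq> {..<b} \<Longrightarrow> guard a = Some (g, w) \<Longrightarrow> g \<in> coords b"
  by (cases a) (auto simp: coords_def)

section \<open>Two max-plus matrices that run a program\<close>

text \<open>
  Matrix entries are addressed by a control state and a coordinate; the list \<open>E\<close> fixes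
  the order. It is left open because the diagonal argument needs the entries of the
  input registers to come first.
\<close>

type_synonym index = "op instr list \<times> coord"

definition row_vec :: "index list \<Rightarrow> (index \<Rightarrow> zmax) \<Rightarrow> zmax mat" where
  "row_vec E z = mat 1 (length E) (\<lambda>(_, j). z (E ! j))"

fun entry :: "bool \<Rightarrow> index \<Rightarrow> index \<Rightarrow> zmax" where
  "entry b (k, c) (k', c') =
     (case succ b k of None \<Rightarrow> 0 | Some (a, k'') \<Rightarrow> if k' = k'' then weight a c c' else 0)"

definition step_mat :: "index list \<Rightarrow> bool \<Rightarrow> zmax mat" where
  "step_mat E b = mat (length E) (length E) (\<lambda>(i, j). entry b (E ! i) (E ! j))"

fun block :: "op instr list \<Rightarrow> (coord \<Rightarrow> zmax) \<Rightarrow> index \<Rightarrow> zmax" where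
  "block k u (k', c) = (if k' = k then u c else 0)"

lemma row_vec_cong: "(\<And>x. x \<in> set E \<Longrightarrow> z x = z' x) \<Longrightarrow> row_vec E z = row_vec E z'"
  unfolding row_vec_def by (intro cong_mat) simp_all

lemma row_vec_times_mat:
  assumes "distinct E"
  shows "row_vec E z * mat (length E) (length E) (\<lambda>(i, j). M (E ! i) (E ! j)) =
    row_vec E (\<lambda>y. \<Sum>x\<in>set E. z x * M x y)"
proof (rule eq_matI)
  fix i j
  assume "i < dim_row (row_vec E (\<lambda>y. \<Sum>x\<in>set E. z x * M x y))"
    "j < dim_col (row_vec E (\<lambda>y. \<Sum>x\<in>set E. z x * M x y))"
  then have ij: "i = 0" "j < length E" by (auto simp: row_vec_def)
  have "(\<Sum>l = 0..<length E. z (E ! l) * M (E ! l) (E ! j)) = (\<Sum>x\<in>set E. z x * M x (E ! j))"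
    by (rule sum.reindex_bij_betw[of "(!) E" "{0..<length E}" "set E" "\<lambda>x. z x * M x (E ! j)"])
      (use assms in \<open>auto intro!: bij_betw_nth\<close>)
  then show "(row_vec E z * mat (length E) (length E) (\<lambda>(i, j). M (E ! i) (E ! j))) $$ (i, j) =
      row_vec E (\<lambda>y. \<Sum>x\<in>set E. z x * M x y) $$ (i, j)"
    using ij by (simp add: row_vec_def scalar_prod_def)
qed (auto simp: row_vec_def)

locale program_matrices =
  fixes P :: "op instr list" and b :: nat and E :: "index list"
  assumes distinct: "distinct E"
    and indices: "set E = conts P [] \<times> coords b"
    and registers: "\<And>a. a \<in> ops P \<Longrightarrow> regs a \<subseteq> {..<b}"
begin

definition letter :: "nat \<Rightarrow> zmax mat" where
  "letter i = (if i = 1 then step_mat E True else step_mat E False)"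

lemma succ_ops:
  assumes "k \<in> conts P []" "succ d k = Some (a, k')"
  shows "k' \<in> conts P []" "regs a \<subseteq> {..<b}"
proof -
  have "k \<noteq> []" using assms(2) by auto
  then show "k' \<in> conts P []" using conts_closed[OF assms] by blast
  have "a \<in> insert Nop (ops k)"
    using assms(2) by (cases "(d, k)" rule: succ.cases) auto
  then have "a \<in> insert Nop (ops P)" using ops_conts[OF assms(1)] by auto
  then show "regs a \<subseteq> {..<b}" using registers by auto
qed

lemma step:
  assumes k: "k \<in> conts P []"
  shows "row_vec E (block k u) * step_mat E d =
    (case succ d k of
       None \<Rightarrow> row_vec E (block k (\<lambda>_. 0))
     | Some (a, k') \<Rightarrow> row_vec E (block k' (transfer a u)))"
proof -
  have fin: "finite (conts P [])" "finite (coords b)"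
    by (auto simp: finite_conts coords_def)
  have sum: "(\<Sum>x\<in>set E. block k u x * entry d x y) = (\<Sum>c\<in>coords b. u c * entry d (k, c) y)" for y
  proof -
    have "(\<Sum>x\<in>set E. block k u x * entry d x y) =
        (\<Sum>k'\<in>conts P []. \<Sum>c\<in>coords b. block k u (k', c) * entry d (k', c) y)"
      unfolding indices sum.cartesian_product by (intro sum.cong) auto
    also have "\<dots> = (\<Sum>k'\<in>conts P []. if k' = k then \<Sum>c\<in>coords b. u c * entry d (k, c) y else 0)"
      by (intro sum.cong) auto
    finally show ?thesis using fin k by simp
  qed
  have prod: "row_vec E (block k u) * step_mat E d =
      row_vec E (\<lambda>y. \<Sum>c\<in>coords b. u c * entry d (k, c) y)"
    unfolding step_mat_def row_vec_times_mat[OF distinct] sum ..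
  show ?thesis
  proof (cases "succ d k")
    case None
    then show ?thesis unfolding prod by (auto intro!: row_vec_cong)
  next
    case (Some r)
    obtain a k' where r: "r = (a, k')" by force
    have regs: "regs a \<subseteq> {..<b}" using succ_ops[OF k] Some r by blast
    have "(\<Sum>c\<in>coords b. u c * entry d (k, c) y) = block k' (transfer a u) y" 
      if y_in: "y \<in> set E" for y
    proof -
      obtain q c' where y: "y = (q, c')" "c' \<in> coords b" using y_in indices by auto
      have "(\<Sum>c\<in>coords b. u c * weight a c c') = transfer a u c'"
        using fin(2) source_in_coords[OF regs y(2)] guard_in_coords[OF regs] by (rule sum_weight)
      then show ?thesis by (simp add: y(1) Some r)
    qed
    then show ?thesis unfolding prod by (auto simp: Some r intro!: row_vec_cong)
  qed
qed

abbreviation read_word :: "zmax mat \<Rightarrow> nat list \<Rightarrow> zmax mat" where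
  "read_word \<equiv> foldl (\<lambda>v i. v * letter i)"

lemma word_of_run:
  assumes "run k s t" "k \<in> conts P []"
  shows "\<exists>w. set w \<subseteq> {1, 2} \<and> (k \<noteq> [] \<longrightarrow> w \<noteq> []) \<and>
    read_word (row_vec E (block k (store_vec s))) w = row_vec E (block [] (store_vec t))"
  using assms
proof (induction rule: run.induct)
  case (Nil s)
  show ?case by (rule exI[of _ "[]"]) simp
next
  case (Op a s u k t)
  have "k \<in> conts P []" using succ_ops(1)[OF Op.prems, of True] by simp
  then obtain w where "set w \<subseteq> {1, 2}"
    "read_word (row_vec E (block k (store_vec u))) w = row_vec E (block [] (store_vec t))"
    using Op.IH by blast
  then show ?case using step[OF Op.prems, of _ True] transfer_store_vec[OF Op.hyps(1)]
    by (intro exI[of _ "1 # w"]) (simp add: letter_def)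
next
  case (Leave k s t p)
  have "k \<in> conts P []" using succ_ops(1)[OF Leave.prems, of True] by simp
  then obtain w where "set w \<subseteq> {1, 2}"
    "read_word (row_vec E (block k (store_vec s))) w = row_vec E (block [] (store_vec t))"
    using Leave.IH by blast
  then show ?case using step[OF Leave.prems, of _ True] transfer_store_vec[of Nop s s]
    by (intro exI[of _ "1 # w"]) (simp add: letter_def)
next
  case (Unroll p k s t)
  have "p @ Star p # k \<in> conts P []" using succ_ops(1)[OF Unroll.prems, of False] by simp
  then obtain w where "set w \<subseteq> {1, 2}"
    "read_word (row_vec E (block (p @ Star p # k) (store_vec s))) w =
     row_vec E (block [] (store_vec t))"
    using Unroll.IH by blast
  then show ?case using step[OF Unroll.prems, of _ False] transfer_store_vec[of Nop s s]
    by (intro exI[of _ "2 # w"]) (simp add: letter_def)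
qed

text \<open>
  After any word the vector is again a single block. It is spoilt, or else it stores the registers of a
  computation that is under way; the latter is expressed by extending every computation from the
  present configuration to one from the initial configuration.
\<close>

lemma read_word_block:
  assumes "k \<in> conts P []"
  shows "\<exists>k'\<in>conts P []. \<exists>u'.
    read_word (row_vec E (block k u)) w = row_vec E (block k' u') \<and>
    (spoilt u \<longrightarrow> spoilt u') \<and>
    (\<forall>s. u = store_vec s \<longrightarrow> spoilt u' \<or>
      (\<exists>s'. u' = store_vec s' \<and> (\<forall>t. run k' s' t \<longrightarrow> run k s t)))"
  using assms
proof (induction w arbitrary: k u)
  case Nil
  then show ?case by fastforce
next
  case (Cons i w)
  define d where "d = (i = 1)"
  have letter: "letter i = step_mat E d" by (simp add: letter_def d_def)
  show ?case
  proof (cases "succ d k")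
    case None
    have "spoilt (\<lambda>_. 0)" by (simp add: spoilt_def)
    moreover obtain k' u' where "k' \<in> conts P []"
      "read_word (row_vec E (block k (\<lambda>_. 0))) w = row_vec E (block k' u')"
      "spoilt (\<lambda>_. 0) \<longrightarrow> spoilt u'"
      using Cons.IH[OF Cons.prems] by blast
    ultimately show ?thesis using step[OF Cons.prems, of u d] None letter by auto
  next
    case (Some r)
    obtain a k1 where r: "r = (a, k1)" by force
    let ?u = "transfer a u"
    have k1: "k1 \<in> conts P []" using succ_ops[OF Cons.prems] Some r by blast
    obtain k' u' where k': "k' \<in> conts P []"
      and eq: "read_word (row_vec E (block k1 ?u)) w = row_vec E (block k' u')"
      and spoilt: "spoilt ?u \<longrightarrow> spoilt u'"
      and good: "\<forall>s. ?u = store_vec s \<longrightarrow> spoilt u' \<or>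
        (\<exists>s'. u' = store_vec s' \<and> (\<forall>t. run k' s' t \<longrightarrow> run k1 s t))"
      using Cons.IH[OF k1, of ?u] by blast
    have "read_word (row_vec E (block k u)) (i # w) = row_vec E (block k' u')"
      using step[OF Cons.prems, of u d] Some r letter eq by simp
    moreover have "spoilt u \<longrightarrow> spoilt u'" using spoilt spoilt_transfer by blast
    moreover have "spoilt u' \<or> (\<exists>s'. u' = store_vec s' \<and> (\<forall>t. run k' s' t \<longrightarrow> run k s t))"
      if u: "u = store_vec s" for s
    proof (cases "exec a s")
      case None
      then show ?thesis using spoilt transfer_stuck u by blast
    next
      case (Some s1)
      have "?u = store_vec s1" using transfer_store_vec[OF Some] u by simp
      then show ?thesis using good run_succ[OF _ Some] \<open>succ d k = Some r\<close> r by blast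
    qed
    ultimately show ?thesis using k' by blast
  qed
qed

text \<open>
  The target has the same finite value at \<open>Ref\<close> and \<open>Dmg\<close> of the block \<open>[]\<close>, and a finite factor preserves
  both finiteness and equality.
\<close>

lemma proportional_final:
  assumes "row_vec E (block k u) \<sim>\<^sub>p row_vec E (block [] (store_vec t))"
  shows "k = [] \<and> \<not> spoilt u"
proof -
  obtain l where l: "\<forall>j<length E. ereal_of_zmax (block k u (E ! j)) =
      ereal l + ereal_of_zmax (block [] (store_vec t) (E ! j))"
    using assms by (auto simp: proportional_def row_vec_def)
  have l: "ereal_of_zmax (block k u x) = ereal l + ereal_of_zmax (block [] (store_vec t) x)"
    if "x \<in> set E" for x
    using that l by (metis in_set_conv_nth)
  have "([], Ref) \<in> set E" "([], Dmg) \<in> set E"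
    unfolding indices by (auto simp: conts_end coords_def)
  then have "ereal_of_zmax (block k u ([], Ref)) = ereal l"
    "ereal_of_zmax (block k u ([], Dmg)) = ereal l"
    using l by force+
  then have "k = []" "u Ref \<noteq> 0" "ereal_of_zmax (u Ref) = ereal_of_zmax (u Dmg)"
    by (auto split: if_splits)
  then show ?thesis by (auto simp: spoilt_def)
qed

text \<open>
  The target prescribes all registers at the end, so the program has to leave them in a fixed state;
  by \<open>final\<close> every terminating computation ends exactly in the target. The program has to be
  nonempty because the empty word is excluded.
\<close>

lemma reachable_iff_run:
  assumes "P \<noteq> []" and final: "\<And>t. run P s t \<Longrightarrow> t = (\<lambda>_. 0)"
  shows "reachable (length E, step_mat E True, step_mat E False,
      row_vec E (block P (store_vec s)), row_vec E (block [] (store_vec (\<lambda>_. 0))))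
    \<longleftrightarrow> (\<exists>t. run P s t)"
    (is "?L \<longleftrightarrow> ?R")
proof
  have P: "P \<in> conts P []" using conts_start[of P "[]"] by simp
  have word: "foldl (\<lambda>v i. v * (if i = 1 then step_mat E True else step_mat E False)) = read_word"
    by (simp add: letter_def)
  {
    assume ?L
    then obtain w where
      "read_word (row_vec E (block P (store_vec s))) w \<sim>\<^sub>p row_vec E (block [] (store_vec (\<lambda>_. 0)))"
      unfolding reachable.simps word by blast
    then show ?R
      using read_word_block[OF P, of "store_vec s" w] proportional_final by (metis run_Nil)
  next
    assume ?R
    then have "run P s (\<lambda>_. 0)" using final by blast
    then obtain w where "set w \<subseteq> {1, 2}" "w \<noteq> []" "read_word (row_vec E (block P (store_vec s))) w =
        row_vec E (block [] (store_vec (\<lambda>_. 0)))"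
      using word_of_run[OF _ P] \<open>P \<noteq> []\<close> by blast
    moreover have "v \<sim>\<^sub>p v" for v
      unfolding proportional_def by (auto intro!: exI[of _ 0] simp flip: zero_ereal_def)
    ultimately show ?L unfolding reachable.simps word by metis
  }
qed

end

section \<open>Computing the code of an instance\<close>

lemma rec_eval_Comp1: "rec_eval g xs a \<Longrightarrow> rec_eval f [a] y \<Longrightarrow> rec_eval (Comp f [g]) xs y"
  by (rule rec_eval.Comp[of _ _ "[a]"]) auto

lemma rec_eval_Comp2:
  "rec_eval g xs a \<Longrightarrow> rec_eval h xs b \<Longrightarrow> rec_eval f [a, b] y \<Longrightarrow> rec_eval (Comp f [g, h]) xs y"
  by (rule rec_eval.Comp[of _ _ "[a, b]"]) auto

lemma rec_eval_Suc: "rec_eval g xs x \<Longrightarrow> rec_eval (Comp Succ [g]) xs (Suc x)"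
  by (rule rec_eval_Comp1[OF _ rec_eval.Succ])

lemma rec_eval_Proj: "i < length xs \<Longrightarrow> y = xs ! i \<Longrightarrow> rec_eval (Proj i) xs y"
  by (simp add: rec_eval.Proj)

definition rf_add :: recf where
  "rf_add = PrimRec (Proj 0) (Comp Succ [Proj 1])"

definition rf_triangle :: recf where
  "rf_triangle = PrimRec Zero (Comp rf_add [Comp Succ [Proj 0], Proj 1])"

definition rf_pred :: recf where
  "rf_pred = PrimRec Zero (Proj 0)"

definition rf_pair :: recf where
  "rf_pair = Comp rf_add [Comp rf_triangle [rf_add], Proj 0]"

lemma rec_eval_add: "rec_eval rf_add [x, y] (x + y)"
proof (induction x)
  case 0
  show ?case unfolding rf_add_def by (auto intro!: rec_eval.PrimRec_0 rec_eval_Proj)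
next
  case (Suc x)
  then show ?case unfolding rf_add_def
    by (auto intro!: rec_eval.PrimRec_Suc[of _ _ x "[y]" "x + y"] rec_eval_Comp1[of _ _ "x + y"]
        rec_eval_Proj rec_eval.Succ)
qed

lemma rec_eval_triangle: "rec_eval rf_triangle [x] (triangle x)"
proof (induction x)
  case 0
  show ?case unfolding rf_triangle_def by (auto intro!: rec_eval.PrimRec_0 rec_eval.Zero)
next
  case (Suc x)
  have "rec_eval (Comp rf_add [Comp Succ [Proj 0], Proj 1]) [x, triangle x] (Suc x + triangle x)"
    by (rule rec_eval_Comp2[OF _ _ rec_eval_add])
      (auto intro!: rec_eval_Comp1[of _ _ x] rec_eval_Proj rec_eval.Succ)
  then show ?case using Suc unfolding rf_triangle_def
    by (auto intro: rec_eval.PrimRec_Suc simp: add.commute)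
qed

lemma rec_eval_pred: "rec_eval rf_pred [x] (x - 1)"
proof (induction x)
  case 0
  show ?case unfolding rf_pred_def by (auto intro!: rec_eval.PrimRec_0 rec_eval.Zero)
next
  case (Suc x)
  then show ?case unfolding rf_pred_def
    by (auto intro!: rec_eval.PrimRec_Suc[of _ _ x "[]" "x - 1"] rec_eval_Proj)
qed

lemma rec_eval_pair: "rec_eval rf_pair [x, y] (prod_encode (x, y))"
  unfolding rf_pair_def prod_encode_def prod.case
  by (intro rec_eval_Comp2[OF _ _ rec_eval_add] rec_eval_Comp1[OF rec_eval_add rec_eval_triangle]
      rec_eval_Proj) auto

text \<open>
  Lists are coded by iterated pairing, and so is the instance; \<open>rf_cons\<close> is the single step.
\<close>

definition rf_cons :: "recf \<Rightarrow> recf \<Rightarrow> recf" where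
  "rf_cons f g = Comp Succ [Comp rf_pair [f, g]]"

lemma rec_eval_cons:
  "rec_eval f xs x \<Longrightarrow> rec_eval g xs (list_encode ys) \<Longrightarrow> rec_eval (rf_cons f g) xs (list_encode (x # ys))"
  unfolding rf_cons_def list_encode.simps
  by (intro rec_eval_Suc rec_eval_Comp2[OF _ _ rec_eval_pair])

definition rf_input :: "nat \<Rightarrow> recf \<Rightarrow> recf" where
  "rf_input i g = (let double = Comp rf_add [Proj i, Proj i] in
     rf_cons (Comp Succ [double]) (rf_cons (Comp Succ [Comp rf_pred [double]]) g))"

definition input_codes :: "nat \<Rightarrow> nat list" where
  "input_codes x = [zmax_encode (Fin (int x)), zmax_encode (Fin (- int x))]"

text \<open>
  The code of \<open>- x\<close> is \<open>Suc (2 * x - 1)\<close> also for \<open>x = 0\<close>, thanks to truncated subtraction.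
\<close>

lemma input_codes: "input_codes x = [Suc (x + x), Suc (x + x - 1)]"
  by (auto simp: input_codes_def int_encode_def sum_encode_def)

lemma rec_eval_input:
  assumes "i < length xs" "rec_eval g xs (list_encode ys)"
  shows "rec_eval (rf_input i g) xs (list_encode (input_codes (xs ! i) @ ys))"
proof -
  have double: "rec_eval (Comp rf_add [Proj i, Proj i]) xs (xs ! i + xs ! i)"
    by (rule rec_eval_Comp2[OF _ _ rec_eval_add]) (use assms(1) in \<open>auto intro: rec_eval.Proj\<close>)
  show ?thesis
    unfolding rf_input_def Let_def input_codes append.simps
    by (intro rec_eval_cons rec_eval_Suc double rec_eval_Comp1[OF double rec_eval_pred] assms(2))
qed

text \<open>
  Of the five inputs, the last is the code of the part of the initial row vector that follows the
  inputs. The inputs occur twice in the instance, as the data from which it is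
  assembled and as entries of its initial vector: this is the self-reference of the diagonal argument.
\<close>

definition rf_inputs :: recf where
  "rf_inputs = foldr rf_input [0..<5] (Proj 4)"

lemma rec_eval_inputs:
  assumes "length xs = 5" "xs ! 4 = list_encode ys"
  shows "rec_eval rf_inputs xs (list_encode (concat (map input_codes xs) @ ys))"
proof -
  have "rec_eval (foldr rf_input is (Proj 4)) xs
      (list_encode (concat (map (\<lambda>i. input_codes (xs ! i)) is) @ ys))"
    if "set is \<subseteq> {..<5}" for "is"
    using that
  proof (induction "is")
    case Nil
    then show ?case using assms by (auto intro!: rec_eval_Proj)
  next
    case (Cons i "is")
    then show ?case using rec_eval_input[of i xs] assms(1) by simp
  qed
  from this[of "[0..<5]"] have "rec_eval rf_inputs xs
      (list_encode (concat (map (\<lambda>i. input_codes (xs ! i)) [0..<5]) @ ys))"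
    unfolding rf_inputs_def by (simp add: atLeast0LessThan)
  moreover have "map (\<lambda>i. input_codes (xs ! i)) [0..<5] = map input_codes xs"
    using assms(1) by (intro nth_equalityI) auto
  ultimately show ?thesis by simp
qed

definition rf_instance :: recf where
  "rf_instance = rf_cons (Proj 0) (rf_cons (Proj 1) (rf_cons (Proj 2)
     (rf_cons (rf_cons rf_inputs Zero) (Proj 3))))"

lemma rec_eval_instance:
  assumes "xs = [n, a, b, list_encode [e], list_encode ys]"
  shows "rec_eval rf_instance xs
    (list_encode [n, a, b, list_encode [list_encode (concat (map input_codes xs) @ ys)], e])"
proof -
  have row: "rec_eval (rf_cons rf_inputs Zero) xs
      (list_encode [list_encode (concat (map input_codes xs) @ ys)])"
    by (rule rec_eval_cons[OF rec_eval_inputs]) (use assms in \<open>auto intro: rec_eval.Zero\<close>)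
  show ?thesis unfolding rf_instance_def
    by (rule rec_eval_cons[OF _ rec_eval_cons[OF _ rec_eval_cons[OF _ rec_eval_cons[OF row]]]])
      (use assms in \<open>auto intro: rec_eval_Proj\<close>)
qed

section \<open>The diagonal argument\<close>

lemma mat_encode_row_vec:
  "mat_encode (row_vec E z) = list_encode [list_encode (map (zmax_encode \<circ> z) E)]"
proof -
  have "mat_to_list (row_vec E z) = [map z E]"
    unfolding mat_to_list_def row_vec_def by (auto intro!: nth_equalityI)
  then show ?thesis by (simp add: mat_encode_def)
qed

lemma enumerate_from:
  assumes "finite S" "distinct xs" "set xs \<subseteq> S"
  obtains ys where "distinct (xs @ ys)" "set (xs @ ys) = S"
proof -
  obtain ys where "set ys = S - set xs" "distinct ys"
    using finite_distinct_list[of "S - set xs"] assms(1) by auto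
  then show ?thesis using assms by (intro that[of ys]) auto
qed

lemma register_bound: "finite A \<Longrightarrow> \<exists>b\<ge>m. \<forall>a\<in>A. regs a \<subseteq> {..<b}"
proof (induction rule: finite_induct)
  case (insert a A)
  then obtain b where b: "b \<ge> m" "\<forall>a\<in>A. regs a \<subseteq> {..<b}" by blast
  have "finite (regs a)" by (cases a) auto
  then obtain d where "regs a \<subseteq> {..<d}" using finite_nat_iff_bounded by blast
  then show ?case using b by (intro exI[of _ "max b d"]) fastforce
qed auto

definition input_store :: "nat list \<Rightarrow> store" where
  "input_store xs = (\<lambda>r. if r < length xs then xs ! r else 0)"

definition input_indices :: "op instr list \<Rightarrow> index list" where
  "input_indices P = concat (map (\<lambda>r. [(P, Pos r), (P, Neg r)]) [0..<5])"

lemma distinct_input_indices: "distinct (input_indices P)"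
  by (simp add: input_indices_def upt_rec numeral_eq_Suc)

lemma set_input_indices: "set (input_indices P) = {P} \<times> (Pos ` {..<5} \<union> Neg ` {..<5})"
  by (auto simp: input_indices_def)

text \<open>
  Only the entries of the input registers depend on the inputs. The remaining ones, listed in \<open>R\<close>, may
  therefore be computed from the all-zero store, which avoids a circular choice of inputs:
  the last input is the code of these entries.
\<close>

lemma input_vector_codes:
  assumes "length xs = 5" "distinct (input_indices P @ R)"
  shows "map (zmax_encode \<circ> block P (store_vec (input_store xs))) (input_indices P @ R) =
    concat (map input_codes xs) @ map (zmax_encode \<circ> block P (store_vec (\<lambda>_. 0))) R"
proof -
  have "map (zmax_encode \<circ> block P (store_vec (input_store xs))) (input_indices P) =
      concat (map (\<lambda>r. input_codes (xs ! r)) [0..<5])"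
    using assms(1)
    by (auto simp: input_indices_def input_codes_def input_store_def map_concat comp_def
        intro!: arg_cong[of _ _ concat])
  moreover have "map (\<lambda>r. input_codes (xs ! r)) [0..<5] = map input_codes xs"
    using assms(1) by (intro nth_equalityI) auto
  moreover have "block P (store_vec (input_store xs)) x = block P (store_vec (\<lambda>_. 0)) x"
    if "x \<in> set R" for x
  proof -
    obtain k c where x: "x = (k, c)" by force
    have "x \<notin> set (input_indices P)" using assms(2) that by auto
    then show ?thesis
      using assms(1) by (cases c) (auto simp: x set_input_indices input_store_def)
  qed
  ultimately show ?thesis by simp
qed

theorem corollary3:
  shows "\<not> decidable reach_encode reach_instances reachable"
proof
  assume "decidable reach_encode reach_instances reachable"
  then obtain f where f: "\<And>X. X \<in> reach_instances \<Longrightarrow>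
      rec_eval f [reach_encode X] (if reachable X then 1 else 0)"
    unfolding decidable_def by blast
  define D where "D = Comp f [rf_instance]"
  \<comment> \<open>The inputs are in the registers below \<open>5\<close>, and the answer is in register \<open>5\<close>. The computation
    goes through only if the answer is no; \<open>Reset\<close> then produces the store of the target.\<close>
  define P where "P = compile D [0..<5] 5 6 @ [Op (Test0 5), Op Reset]"
  \<comment> \<open>At least \<open>5\<close>, for the vector has to contain all input registers.\<close>
  obtain b where b: "b \<ge> 5" "\<forall>a\<in>ops P. regs a \<subseteq> {..<b}"
    using register_bound[of "ops P" 5] by (auto simp: ops_def finite_set_instr)
  have "P \<in> conts P []" using conts_start[of P "[]"] by simp
  then have "set (input_indices P) \<subseteq> conts P [] \<times> coords b"
    using b(1) by (auto simp: set_input_indices coords_def)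
  then obtain R where R: "distinct (input_indices P @ R)"
    "set (input_indices P @ R) = conts P [] \<times> coords b"
    using enumerate_from[OF _ distinct_input_indices] by (metis finite_SigmaI finite_conts
        finite_Un finite_imageI finite_lessThan finite.intros coords_def)
  define E where "E = input_indices P @ R"
  interpret program_matrices P b E
    using R b(2) by unfold_locales (auto simp: E_def)
  define \<eta> where "\<eta> = row_vec E (block [] (store_vec (\<lambda>_. 0)))"
  define ys where "ys = map (zmax_encode \<circ> block P (store_vec (\<lambda>_. 0))) R"
  \<comment> \<open>The inputs that describe the program \<open>P\<close> itself.\<close>
  define xs where "xs = [length E, mat_encode (step_mat E True), mat_encode (step_mat E False),
    list_encode [mat_encode \<eta>], list_encode ys]"
  define X where "X = (length E, step_mat E True, step_mat E False,
    row_vec E (block P (store_vec (input_store xs))), \<eta>)"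
  have "P \<noteq> []" by (simp add: P_def)
  have "E \<noteq> []" by (simp add: E_def input_indices_def upt_conv_Cons)
  then have X: "X \<in> reach_instances"
    by (simp add: X_def reach_instances_def \<eta>_def row_vec_def step_mat_def Suc_leI)
  have "length xs = 5" by (simp add: xs_def)
  then have "reach_encode X = list_encode [xs ! 0, xs ! 1, xs ! 2,
      list_encode [list_encode (concat (map input_codes xs) @ ys)], mat_encode \<eta>]"
    unfolding X_def reach_encode.simps mat_encode_row_vec[of E "block P _"]
    unfolding input_vector_codes[OF _ R(1), of xs, folded E_def ys_def, OF \<open>length xs = 5\<close>]
    by (simp add: xs_def del: list_encode.simps list.map concat.simps)
  then have code: "rec_eval rf_instance xs (reach_encode X)"
    using rec_eval_instance[of xs] by (simp add: xs_def del: list_encode.simps)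
  have D: "rec_eval D xs (if reachable X then 1 else 0)"
    unfolding D_def using code f[OF X] by (rule rec_eval_Comp1)
  have inputs: "map (input_store xs) [0..<5] = xs"
    using \<open>length xs = 5\<close> by (intro nth_equalityI) (auto simp: input_store_def)
  have "reachable X \<longleftrightarrow> (\<exists>t. run P (input_store xs) t)"
    unfolding X_def \<eta>_def by (rule reachable_iff_run[OF \<open>P \<noteq> []\<close>]) (auto simp: P_def)
  also have "\<dots> \<longleftrightarrow> rec_eval D xs 0"
  proof
    assume "\<exists>t. run P (input_store xs) t"
    then obtain t where "run (compile D [0..<5] 5 6) (input_store xs) t" "t 5 = 0"
      by (auto simp: P_def)
    then show "rec_eval D xs 0"
      using computes_sound(1)[OF computes_compile, of D "[0..<5]" 5 6 "input_store xs" t]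
      unfolding inputs by (auto simp: subset_iff)
  next
    assume "rec_eval D xs 0"
    then obtain t where "run (compile D [0..<5] 5 6) (input_store xs) t" "t 5 = 0"
      using computes_complete[OF computes_compile, of D "input_store xs" "[0..<5]" 0 6 5]
      unfolding inputs by (auto simp: subset_iff)
    then show "\<exists>t. run P (input_store xs) t" by (auto simp: P_def)
  qed
  also have "\<dots> \<longleftrightarrow> \<not> reachable X"
    using D rec_eval_deterministic by (metis zero_neq_one)
  finally show False by blast
qed

end
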